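(* There exist a sequence of piecewise linear functions $\{\varphi_n\}_{n\ge 1}$ in $C[0,1]$ and a sequence $\{A_n\}_{n\ge 1}$ in $C[0,1]^*$ such that $\{(\varphi_n,A_n)\}_{n\ge 1}$ is a Schauder frame of $C[0,1]$ but $\{\varphi_n\}_{n\ge 1}$ is not a Schauder basis of $C[0,1]$.
   Context: $C[0,1]$ is the Banach space of continuous $\mathbb{K}$-valued functions on $[0,1]$ with the supremum norm, $\mathbb{K}\in\{\mathbb{R},\mathbb{C}\}$; $X^*$ denotes the topological dual of $X$. A Schauder basis of a Banach space $X$ is a sequence $(x_n)_{n\ge 1}$ in $X$ such that for every $x\in X$ there is a unique sequence of scalars $(\alpha_n)_{n\ge1}$ with $x=\sum_{n=1}^{\infty}\alpha_n x_n$ (norm convergence). A Schauder frame of $X$ is a sequence $\{(x_n,f_n)\}_{n\ge 1}\subset X\times X^*$ such that for every $x\in X$ the series $\sum_n f_n(x)x_n$ converges in norm to $x$. *)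

theory Defs
  imports "HOL-Analysis.Analysis"
begin

section \<open>Schauder bases and Schauder frames\<close>

text \<open>
  A vector space over the scalar field \<open>'k\<close> is a type \<open>'v\<close> carrying a norm, together with its
  scalar multiplication \<open>s\<close>, which is passed explicitly because the library has no type class of
  normed spaces over a field other than the reals. Sequences are indexed from 0.
\<close>

definition topological_dual ::
    "('k::real_normed_field \<Rightarrow> 'v::real_normed_vector \<Rightarrow> 'v) \<Rightarrow> ('v \<Rightarrow> 'k) set" where
  "topological_dual s = {f. Vector_Spaces.linear s (*) f \<and> continuous_on UNIV f}"

definition schauder_basis ::
    "('k::real_normed_field \<Rightarrow> 'v::real_normed_vector \<Rightarrow> 'v) \<Rightarrow> (nat \<Rightarrow> 'v) \<Rightarrow> bool" where
  "schauder_basis s x \<longleftrightarrow> (\<forall>v. \<exists>!\<alpha>. (\<lambda>n. s (\<alpha> n) (x n)) sums v)"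

definition schauder_frame ::
    "('k::real_normed_field \<Rightarrow> 'v::real_normed_vector \<Rightarrow> 'v) \<Rightarrow> (nat \<Rightarrow> 'v) \<Rightarrow> (nat \<Rightarrow> 'v \<Rightarrow> 'k) \<Rightarrow> bool" where
  "schauder_frame s x f \<longleftrightarrow>
     (\<forall>n. f n \<in> topological_dual s) \<and> (\<forall>v. (\<lambda>n. s (f n v) (x n)) sums v)"


section \<open>The space of continuous functions on the unit interval\<close>

typedef unit_interval = "{0..1::real}"
  morphisms real_of_unit Abs_unit
  by (rule exI[of _ 0]) simp

instantiation unit_interval :: metric_space
begin

definition "dist s t = dist (real_of_unit s) (real_of_unit t)"

definition "(uniformity :: (unit_interval \<times> unit_interval) filter) =
  (INF e\<in>{0<..}. principal {(s, t). dist s t < e})"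

definition "open (U :: unit_interval set) \<longleftrightarrow>
  (\<forall>s\<in>U. \<forall>\<^sub>F (s', t) in uniformity. s' = s \<longrightarrow> t \<in> U)"

instance
proof
  fix s t u :: unit_interval
  show "dist s t = 0 \<longleftrightarrow> s = t"
    by (simp add: dist_unit_interval_def real_of_unit_inject)
  show "dist s t \<le> dist s u + dist t u"
    by (simp add: dist_unit_interval_def dist_triangle2)
qed (rule uniformity_unit_interval_def open_unit_interval_def)+

end

text \<open>
  The unit interval is compact, so the bounded continuous functions are all the continuous ones
  (lemma \<open>ex_C01\<close>), and the norm of \<open>bcontfun\<close> is the supremum norm.
\<close>

type_synonym 'k C01 = "unit_interval \<Rightarrow>\<^sub>C 'k"

lemma continuous_on_real_of_unit: "continuous_on A real_of_unit"
  by (auto simp: continuous_on_iff dist_unit_interval_def)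

lemma ex_C01:
  fixes g :: "real \<Rightarrow> 'k::real_normed_vector"
  assumes "continuous_on {0..1} g"
  shows "\<exists>f :: 'k C01. \<forall>t. apply_bcontfun f t = g (real_of_unit t)"
proof -
  have "continuous_on UNIV (\<lambda>t. g (real_of_unit t))"
    by (rule continuous_on_compose2[OF assms continuous_on_real_of_unit]) (use real_of_unit in blast)
  moreover have "bounded (g ` {0..1})"
    by (intro compact_imp_bounded compact_continuous_image assms) simp
  then have "bounded (range (\<lambda>t. g (real_of_unit t)))"
    by (rule bounded_subset) (use real_of_unit in blast)
  ultimately have "(\<lambda>t. g (real_of_unit t)) \<in> bcontfun"
    by (simp add: bcontfun_def)
  then show ?thesis
    by (metis Bcontfun_inverse)
qed

definition scaleC01 :: "'k::real_normed_field \<Rightarrow> 'k C01 \<Rightarrow> 'k C01" where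
  "scaleC01 c f = Bcontfun (\<lambda>t. c * apply_bcontfun f t)"

lemma apply_scaleC01 [simp]: "apply_bcontfun (scaleC01 c f) t = c * apply_bcontfun f t"
proof -
  have "continuous_on UNIV (apply_bcontfun f)" "bounded (range (apply_bcontfun f))"
    using apply_bcontfun[of f] by (simp_all add: bcontfun_def)
  moreover from this have "bounded ((*) c ` range (apply_bcontfun f))"
    by (intro bounded_linear_image bounded_linear_mult_right)
  ultimately have "(\<lambda>t. c * apply_bcontfun f t) \<in> bcontfun"
    by (auto simp: bcontfun_def image_image intro: continuous_intros)
  then show ?thesis
    by (simp add: scaleC01_def Bcontfun_inverse)
qed

lemma vector_space_scaleC01: "vector_space scaleC01"
  by unfold_locales (auto intro!: bcontfun_eqI simp: algebra_simps)

lemma scaleC01_real: "scaleC01 (c::real) f = c *\<^sub>R f"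
  by (auto intro!: bcontfun_eqI)

text \<open>
  Continuity is part of the type \<open>C01\<close>. The slope and intercept of each piece are elements of
  the scalar field.
\<close>

definition piecewise_linear :: "'k::real_normed_field C01 \<Rightarrow> bool" where
  "piecewise_linear f \<longleftrightarrow>
     (\<exists>(m::nat) (p :: nat \<Rightarrow> real).
        p 0 = 0 \<and> p m = 1 \<and> (\<forall>i<m. p i < p (Suc i)) \<and>
        (\<forall>i<m. \<exists>a b. \<forall>t. real_of_unit t \<in> {p i..p (Suc i)} \<longrightarrow>
           apply_bcontfun f t = a * of_real (real_of_unit t) + b))"

end

theory Submission
  imports Defs "HOL-Library.Discrete_Functions"
begin

text \<open>
  The frame is a redundant Faber-Schauder system. The index \<open>n\<close> with
  \<open>2 ^ m \<le> n < 2 ^ (m + 1)\<close> belongs to level \<open>m\<close>; its vector is the tent of height 1 and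
  half-width \<open>1 / 2 ^ m\<close> centred at the dyadic point \<open>(n + 1) / 2 ^ m - 1\<close>. Thus level \<open>m\<close> has
  tents at all points \<open>k / 2 ^ m\<close> with \<open>1 \<le> k \<le> 2 ^ m\<close>, including those where coarser levels already
  have one; the index 0 contributes the tent at 0 on level 0.

  The coefficients come from a greedy expansion: the residual starts as \<open>f\<close>, and step \<open>n\<close> subtracts
  the multiple of tent \<open>n\<close> that makes the residual vanish at the centre of that tent. Partial sums
  therefore telescope to \<open>f\<close> minus the residual, and the coefficients are continuous linear
  functionals; it remains to see that the residual tends to 0.

  Tents of one level vanish at each other's centres, so after level \<open>m\<close> the residual is 0 at every
  \<open>k / 2 ^ m\<close>. What has been subtracted is affine between neighbouring points of this grid, as all
  tents up to level \<open>m\<close> are. Hence it is the linear interpolation of \<open>f\<close> on the grid, and the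
  residual is small by uniform continuity of \<open>f\<close> (\<open>norm_residual_grid\<close>). In the middle of a level the
  residual is at most twice as large as at its beginning, because the tents of one level are
  nonnegative and add up to at most 1 (\<open>norm_residual_block\<close>).

  The tents are no basis: the point 1 is a centre on level 0 (index 1) and again on level 1
  (index 3). When step 3 is reached the residual already vanishes there, so the coefficient
  functional with index 3 is zero, whereas tent 3 is trivially a multiple of itself. This gives
  tent 3 two different expansions.
\<close>

section \<open>Tents centred at dyadic points\<close>

definition hat :: "real \<Rightarrow> real" where
  "hat y = max 0 (1 - \<bar>y\<bar>)"

text \<open>
  Since \<open>floor_log 0 = 0\<close>, the indices 0 and 1 both have level 0: their tents are \<open>1 - t\<close> and \<open>t\<close>.
\<close>

definition tent :: "nat \<Rightarrow> real \<Rightarrow> real" where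
  "tent n t = hat (2 ^ floor_log n * (t + 1) - real (Suc n))"

definition tentC01 :: "nat \<Rightarrow> 'k::real_normed_field C01" where
  "tentC01 n = Bcontfun (\<lambda>u. of_real (tent n (real_of_unit u)))"

definition node :: "nat \<Rightarrow> unit_interval" where
  "node n = Abs_unit (real (Suc n) / 2 ^ floor_log n - 1)"

lemma floor_log_bounds: "n < 2 ^ Suc (floor_log n)" "0 < n \<Longrightarrow> 2 ^ floor_log n \<le> n"
  using floor_log_exp2_gt[of n] floor_log_exp2_le[of n] by simp_all

lemma floor_log_block:
  assumes "2 ^ m \<le> n" "n < 2 ^ Suc m"
  shows "floor_log n = m"
  using assms by (intro floor_log_eqI) auto

lemma apply_tentC01 [simp]:
  "apply_bcontfun (tentC01 n) u = of_real (tent n (real_of_unit u))"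
proof -
  have "continuous_on {0..1} (\<lambda>t. of_real (tent n t) :: 'a)"
    unfolding tent_def hat_def by (intro continuous_intros)
  then obtain f :: "'a C01" where f: "\<forall>u. apply_bcontfun f u = of_real (tent n (real_of_unit u))"
    using ex_C01 by blast
  then have "apply_bcontfun f = (\<lambda>u. of_real (tent n (real_of_unit u)))"
    by auto
  then have "tentC01 n = f"
    by (metis apply_bcontfun_inverse tentC01_def)
  then show ?thesis
    using f by simp
qed

lemma apply_bcontfun_sum:
  "apply_bcontfun (\<Sum>i\<in>I. g i) u = (\<Sum>i\<in>I. apply_bcontfun (g i) u)"
  by (induction I rule: infinite_finite_induct) simp_all

lemma real_of_unit_bounds: "0 \<le> real_of_unit u" "real_of_unit u \<le> 1"
  using real_of_unit[of u] by auto

lemma real_of_node: "real_of_unit (node n) = real (Suc n) / 2 ^ floor_log n - 1"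
proof -
  have "real (Suc n) \<le> real (2 ^ Suc (floor_log n))"
    using floor_log_bounds(1)[of n] by (intro of_nat_mono) simp
  moreover have "real (2 ^ floor_log n) \<le> real (Suc n)"
    using floor_log_bounds(2)[of n] by (intro of_nat_mono) (cases "n = 0", auto)
  ultimately have "real (Suc n) / 2 ^ floor_log n - 1 \<in> {0..1}"
    by (auto simp: field_simps)
  then show ?thesis
    unfolding node_def by (rule Abs_unit_inverse)
qed

lemma tent_node_self: "tent n (real_of_unit (node n)) = 1"
  unfolding tent_def real_of_node hat_def by simp

lemma tent_node_other:
  assumes "floor_log i = floor_log n" "i \<noteq> n"
  shows "tent n (real_of_unit (node i)) = 0"
proof -
  have "1 \<le> \<bar>real i - real n\<bar>"
    using assms(2) by linarith
  then show ?thesis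
    using assms(1) unfolding tent_def real_of_node hat_def by simp
qed

text \<open>
  After step 0 nothing changes at the left endpoint, so 0 need not be a centre on later levels.
\<close>

lemma tent_at_0: "0 < n \<Longrightarrow> tent n 0 = 0"
proof -
  assume "0 < n"
  then have "real (2 ^ floor_log n) \<le> real n"
    using floor_log_bounds(2) of_nat_mono by blast
  then have "2 ^ floor_log n - real (Suc n) \<le> -1"
    by simp
  then have "hat (2 ^ floor_log n - real (Suc n)) = 0"
    unfolding hat_def by linarith
  then show ?thesis
    by (simp add: tent_def)
qed

section \<open>Functions affine on the cells of a dyadic grid\<close>

definition dyadic_linear :: "nat \<Rightarrow> 'k::real_normed_field C01 \<Rightarrow> bool" where
  "dyadic_linear m g \<longleftrightarrow> (\<forall>j. \<exists>a b. \<forall>u.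
     real_of_unit u \<in> {real j / 2 ^ m .. real (Suc j) / 2 ^ m} \<longrightarrow>
     apply_bcontfun g u = a * of_real (real_of_unit u) + b)"

lemma hat_linear_between_integers:
  "\<exists>a b. \<forall>y\<in>{of_int d..of_int d + 1}. hat y = a * y + b"
proof -
  consider "d \<le> -2" | "d = -1" | "d = 0" | "1 \<le> d"
    by linarith
  then show ?thesis
  proof cases
    case 1
    then have "real_of_int d \<le> -2" by linarith
    then show ?thesis by (intro exI[of _ 0]) (auto simp: hat_def)
  next
    case 2
    then show ?thesis by (intro exI[of _ 1]) (auto simp: hat_def)
  next
    case 3
    then show ?thesis by (intro exI[of _ "-1"] exI[of _ 1]) (auto simp: hat_def)
  next
    case 4
    then have "real_of_int d \<ge> 1" by linarith
    then show ?thesis by (intro exI[of _ 0]) (auto simp: hat_def)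
  qed
qed

text \<open>
  In the rescaled variable the kinks of a tent of level \<open>l \<le> m\<close> are integers, hence points of the
  grid of width \<open>1 / 2 ^ l\<close>, of which the grid of width \<open>1 / 2 ^ m\<close> is a refinement.
\<close>

lemma dyadic_linear_tent:
  assumes "floor_log n \<le> m"
  shows "dyadic_linear m (tentC01 n)"
  unfolding dyadic_linear_def
proof
  fix j :: nat
  define l where "l = floor_log n"
  \<comment> \<open>the cell of width \<open>1 / 2 ^ l\<close> that contains cell \<open>j\<close>\<close>
  define q where "q = j div 2 ^ (m - l)"
  define d where "d = int q + 2 ^ l - int (Suc n)"
  have m: "(2::real) ^ m = 2 ^ l * 2 ^ (m - l)"
    using assms by (simp add: l_def flip: power_add)
  have "q * 2 ^ (m - l) \<le> j"
    by (simp add: q_def)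
  then have lo: "real q * 2 ^ (m - l) \<le> real j"
    by (metis of_nat_mono of_nat_mult of_nat_numeral of_nat_power)
  have "Suc j \<le> Suc q * 2 ^ (m - l)"
    unfolding q_def Suc_le_eq by (metis dividend_less_div_times mult_Suc add.commute zero_less_numeral zero_less_power)
  then have "real (Suc j) \<le> real (Suc q * 2 ^ (m - l))"
    by (rule of_nat_mono)
  then have hi: "real (Suc j) \<le> real (Suc q) * 2 ^ (m - l)"
    by (simp only: of_nat_mult of_nat_power of_nat_numeral)
  obtain a b where ab: "\<forall>y\<in>{of_int d..of_int d + 1}. hat y = a * y + b"
    using hat_linear_between_integers by blast
  show "\<exists>a b. \<forall>u. real_of_unit u \<in> {real j / 2 ^ m..real (Suc j) / 2 ^ m} \<longrightarrow>
     apply_bcontfun (tentC01 n :: 'a C01) u = a * of_real (real_of_unit u) + b"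
  proof (rule exI, rule exI, intro allI impI)
    fix u assume u: "real_of_unit u \<in> {real j / 2 ^ m..real (Suc j) / 2 ^ m}"
    have "real j \<le> real_of_unit u * 2 ^ m" "real_of_unit u * 2 ^ m \<le> real (Suc j)"
      using u by (simp_all add: field_simps)
    then have "real q * 2 ^ (m - l) \<le> (real_of_unit u * 2 ^ l) * 2 ^ (m - l)"
      "(real_of_unit u * 2 ^ l) * 2 ^ (m - l) \<le> real (Suc q) * 2 ^ (m - l)"
      using lo hi by (simp_all only: m mult.assoc)
    then have "real q \<le> real_of_unit u * 2 ^ l" "real_of_unit u * 2 ^ l \<le> real (Suc q)"
      by simp_all
    then have "2 ^ l * (real_of_unit u + 1) - real (Suc n) \<in> {of_int d..of_int d + 1}"
      by (simp add: d_def algebra_simps)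
    then have "tent n (real_of_unit u) = a * (2 ^ l * (real_of_unit u + 1) - real (Suc n)) + b"
      using ab unfolding tent_def l_def by blast
    also have "\<dots> = (a * 2 ^ l) * real_of_unit u + (a * (2 ^ l - real (Suc n)) + b)"
      by (simp add: algebra_simps)
    finally show "apply_bcontfun (tentC01 n) u = of_real (a * 2 ^ l) * of_real (real_of_unit u) +
        of_real (a * (2 ^ l - real (Suc n)) + b)"
      by (simp only: apply_tentC01 of_real_add of_real_mult)
  qed
qed

lemma dyadic_linear_imp_piecewise_linear:
  assumes "dyadic_linear m g"
  shows "piecewise_linear g"
  unfolding piecewise_linear_def
  by (rule exI[of _ "2 ^ m"], rule exI[of _ "\<lambda>i. real i / 2 ^ m"])
    (use assms in \<open>auto simp: dyadic_linear_def divide_strict_right_mono\<close>)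

lemma dyadic_linear_0: "dyadic_linear m 0"
  unfolding dyadic_linear_def by (intro allI exI[of _ 0]) simp

lemma dyadic_linear_add_scale:
  assumes "dyadic_linear m g" "dyadic_linear m h"
  shows "dyadic_linear m (g + scaleC01 c h)"
  unfolding dyadic_linear_def
proof
  fix j
  obtain a b where ab: "\<forall>u. real_of_unit u \<in> {real j / 2 ^ m .. real (Suc j) / 2 ^ m} \<longrightarrow>
     apply_bcontfun g u = a * of_real (real_of_unit u) + b"
    using assms(1) unfolding dyadic_linear_def by blast
  obtain a' b' where ab': "\<forall>u. real_of_unit u \<in> {real j / 2 ^ m .. real (Suc j) / 2 ^ m} \<longrightarrow>
     apply_bcontfun h u = a' * of_real (real_of_unit u) + b'"
    using assms(2) unfolding dyadic_linear_def by blast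
  show "\<exists>a b. \<forall>u. real_of_unit u \<in> {real j / 2 ^ m .. real (Suc j) / 2 ^ m} \<longrightarrow>
     apply_bcontfun (g + scaleC01 c h) u = a * of_real (real_of_unit u) + b"
    using ab ab' by (intro exI[of _ "a + c * a'"] exI[of _ "b + c * b'"]) (simp add: algebra_simps)
qed

section \<open>The greedy expansion\<close>

primrec residual :: "nat \<Rightarrow> 'k::real_normed_field C01 \<Rightarrow> 'k C01" where
  "residual 0 f = f"
| "residual (Suc n) f = residual n f - scaleC01 (apply_bcontfun (residual n f) (node n)) (tentC01 n)"

definition tent_coeff :: "nat \<Rightarrow> 'k::real_normed_field C01 \<Rightarrow> 'k" where
  "tent_coeff n f = apply_bcontfun (residual n f) (node n)"

lemma sum_tent_coeff: "(\<Sum>i<n. scaleC01 (tent_coeff i f) (tentC01 i)) = f - residual n f"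
  by (induction n) (simp_all add: tent_coeff_def)

lemma dyadic_linear_diff_residual:
  "n \<le> 2 ^ Suc m \<Longrightarrow> dyadic_linear m (f - residual n f)"
proof (induction n)
  case 0
  then show ?case by (simp add: dyadic_linear_0)
next
  case (Suc n)
  have "floor_log n \<le> m"
  proof (cases "n = 0")
    case False
    then have "2 ^ floor_log n < (2::nat) ^ Suc m"
      using floor_log_bounds(2)[of n] Suc.prems by linarith
    then show ?thesis
      by (simp only: power_strict_increasing_iff one_less_numeral_iff semiring_norm less_Suc_eq_le)
  qed simp
  then have "dyadic_linear m (f - residual n f + scaleC01 (apply_bcontfun (residual n f) (node n)) (tentC01 n))"
    using Suc by (intro dyadic_linear_add_scale dyadic_linear_tent) simp_all
  then show ?case
    by (simp add: algebra_simps)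
qed

section \<open>Size of the residual\<close>

lemma residual_unchanged:
  assumes "n \<le> n'" "\<And>i. n \<le> i \<Longrightarrow> i < n' \<Longrightarrow> tent i (real_of_unit u) = 0"
  shows "apply_bcontfun (residual n' f) u = apply_bcontfun (residual n f) u"
  using assms by (induction n' rule: dec_induct) simp_all

text \<open>
  The residual is made 0 at the centre of tent \<open>i\<close> in step \<open>i\<close>, and the later tents of the same
  level vanish there.
\<close>

lemma residual_block_eq_0:
  assumes "2 ^ m \<le> i" "i < n" "n \<le> 2 ^ Suc m"
  shows "apply_bcontfun (residual n f) (node i) = 0"
proof -
  have "apply_bcontfun (residual n f) (node i) = apply_bcontfun (residual (Suc i) f) (node i)"
    using assms by (intro residual_unchanged tent_node_other) (simp_all add: floor_log_block[of m])
  then show ?thesis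
    by (simp add: tent_node_self)
qed

lemma residual_grid_eq_0:
  assumes "real_of_unit u = real k / 2 ^ m"
  shows "apply_bcontfun (residual (2 ^ Suc m) f) u = 0"
proof (cases "k = 0")
  case True
  have u: "u = node 0"
    by (rule real_of_unit_inject[THEN iffD1]) (use assms True real_of_node[of 0] in simp)
  have "apply_bcontfun (residual (2 ^ Suc m) f) u = apply_bcontfun (residual 1 f) u"
    using assms True by (intro residual_unchanged) (simp_all add: tent_at_0)
  then show ?thesis
    by (simp add: u tent_node_self)
next
  case False
  have "real k / 2 ^ m \<le> 1"
    using assms real_of_unit_bounds(2)[of u] by simp
  then have "real k \<le> real (2 ^ m)"
    by simp
  then have k: "k \<le> 2 ^ m"
    by (simp only: of_nat_le_iff)
  define i where "i = 2 ^ m + (k - 1)"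
  have i: "2 ^ m \<le> i" "i < 2 ^ Suc m"
    using k False by (auto simp: i_def)
  have "real (Suc i) = 2 ^ m + real k"
    using False by (simp add: i_def)
  then have "u = node i"
    by (intro real_of_unit_inject[THEN iffD1])
      (simp add: real_of_node floor_log_block[OF i] assms add_divide_distrib del: of_nat_Suc)
  then show ?thesis
    using residual_block_eq_0[OF i] by simp
qed

text \<open>
  On a cell with endpoints \<open>a\<close> and \<open>b\<close>, the partial sum \<open>f - R\<close> is affine and agrees with \<open>f\<close> at
  \<open>a\<close> and \<open>b\<close>. So at the point dividing the cell in the ratio \<open>s : 1 - s\<close> the residual is the convex
  combination of the differences of \<open>f\<close> to \<open>f a\<close> and to \<open>f b\<close>.
\<close>

lemma norm_residual_grid:
  assumes osc: "\<And>u v. dist u v \<le> 1 / 2 ^ m \<Longrightarrow> norm (apply_bcontfun f u - apply_bcontfun f v) \<le> e"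
  shows "norm (residual (2 ^ Suc m) f) \<le> e"
proof (rule norm_bound)
  fix u
  define R where "R = residual (2 ^ Suc m) f"
  define t where "t = real_of_unit u"
  \<comment> \<open>the right endpoint is put into the last cell\<close>
  define j where "j = (if t = 1 then 2 ^ m - 1 else nat \<lfloor>t * 2 ^ m\<rfloor>)"
  have t: "0 \<le> t" "t \<le> 1"
    using real_of_unit_bounds by (simp_all add: t_def)
  have j: "j < 2 ^ m" "real j \<le> t * 2 ^ m" "t * 2 ^ m \<le> real (Suc j)"
  proof -
    have "j < 2 ^ m \<and> real j \<le> t * 2 ^ m \<and> t * 2 ^ m \<le> real (Suc j)"
    proof (cases "t = 1")
      case True
      then show ?thesis by (simp add: j_def of_nat_diff)
    next
      case False
      then have "t * 2 ^ m < 2 ^ m" using t by simp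
      then show ?thesis
        using t False real_of_int_floor_add_one_ge[of "t * 2 ^ m"]
        by (auto simp: j_def nat_less_iff floor_less_iff add.commute)
    qed
    then show "j < 2 ^ m" "real j \<le> t * 2 ^ m" "t * 2 ^ m \<le> real (Suc j)" by auto
  qed
  define a b where "a = Abs_unit (real j / 2 ^ m)" and "b = Abs_unit (real (Suc j) / 2 ^ m)"
  have "real (Suc j) \<le> real (2 ^ m)"
    using j(1) by (intro of_nat_mono) simp
  then have a: "real_of_unit a = real j / 2 ^ m" and b: "real_of_unit b = real (Suc j) / 2 ^ m"
    unfolding a_def b_def by (simp_all add: Abs_unit_inverse del: of_nat_Suc)
  obtain c d where cd: "\<forall>v. real_of_unit v \<in> {real j / 2 ^ m .. real (Suc j) / 2 ^ m} \<longrightarrow>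
      apply_bcontfun (f - R) v = c * of_real (real_of_unit v) + d"
    using dyadic_linear_diff_residual[of "2 ^ Suc m" m f] unfolding dyadic_linear_def R_def by blast
  define s where "s = t * 2 ^ m - real j"
  have s: "0 \<le> s" "s \<le> 1"
    using j by (simp_all add: s_def)
  have ts: "t = (1 - s) * real_of_unit a + s * real_of_unit b"
    unfolding a b s_def by (simp add: field_simps)
  have "apply_bcontfun (f - R) u = c * of_real t + d"
    using cd j by (simp add: t_def field_simps)
  also have "\<dots> = of_real (1 - s) * (c * of_real (real_of_unit a) + d)
      + of_real s * (c * of_real (real_of_unit b) + d)"
    unfolding ts by (simp add: algebra_simps)
  also have "c * of_real (real_of_unit a) + d = apply_bcontfun (f - R) a"
    using cd by (simp add: a divide_right_mono)
  also have "c * of_real (real_of_unit b) + d = apply_bcontfun (f - R) b"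
    using cd by (simp add: b divide_right_mono)
  also have "apply_bcontfun (f - R) a = apply_bcontfun f a"
    using residual_grid_eq_0[OF a] by (simp add: R_def)
  also have "apply_bcontfun (f - R) b = apply_bcontfun f b"
    using residual_grid_eq_0[OF b] by (simp add: R_def)
  finally have "apply_bcontfun R u = of_real (1 - s) * (apply_bcontfun f u - apply_bcontfun f a)
      + of_real s * (apply_bcontfun f u - apply_bcontfun f b)"
    by (simp add: algebra_simps)
  also have "norm \<dots> \<le> (1 - s) * e + s * e"
  proof (rule norm_triangle_le, rule add_mono)
    have "real j / 2 ^ m \<le> t" "t \<le> real (Suc j) / 2 ^ m"
      using j(2,3) by (simp_all add: field_simps)
    then have "dist u a \<le> 1 / 2 ^ m" "dist u b \<le> 1 / 2 ^ m"
      by (auto simp: dist_unit_interval_def dist_real_def a b add_divide_distrib simp flip: t_def)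
    then show "norm (of_real (1 - s) * (apply_bcontfun f u - apply_bcontfun f a)) \<le> (1 - s) * e"
      "norm (of_real s * (apply_bcontfun f u - apply_bcontfun f b)) \<le> s * e"
      unfolding norm_mult norm_of_real using s osc by (auto intro: mult_left_mono)
  qed
  finally show "norm (apply_bcontfun (residual (2 ^ Suc m) f) u) \<le> e"
    by (simp add: R_def algebra_simps)
qed

text \<open>
  The sum of consecutive hats is a trapezium; only its flat top and its right flank are recorded,
  since each further hat raises the right flank of the preceding sum to height 1.
\<close>

lemma sum_hat_le: "a \<le> b \<Longrightarrow> (\<Sum>i=a..<b. hat (y - real (Suc i))) \<le> min 1 (max 0 (real (Suc b) - y))"
proof (induction b rule: dec_induct)
  case base
  then show ?case by simp
next
  case (step b)
  have "min 1 (max 0 (real (Suc b) - y)) + hat (y - real (Suc b)) \<le> min 1 (max 0 (real (Suc (Suc b)) - y))"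
    unfolding hat_def by (simp add: min_def max_def abs_if split: if_splits)
  then show ?case
    using step by (simp only: sum.atLeastLessThan_Suc)
qed

text \<open>
  Within a level no step disturbs the residual at the centres still to come, so each coefficient is
  the value of the residual from the beginning of the level, and the sum subtracted so far is
  bounded by the norm of that residual.
\<close>

lemma norm_residual_block:
  assumes "2 ^ m \<le> n" "n \<le> 2 ^ Suc m"
  shows "norm (residual n f) \<le> 2 * norm (residual (2 ^ m) f)"
proof (rule norm_bound)
  fix u
  define R where "R = residual (2 ^ m) f"
  have "residual n f = R - (\<Sum>i=2^m..<n. scaleC01 (apply_bcontfun R (node i)) (tentC01 i))"
    using assms
  proof (induction n rule: dec_induct)
    case base
    then show ?case by (simp add: R_def)
  next
    case (step n)
    have "apply_bcontfun (residual n f) (node n) = apply_bcontfun R (node n)"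
      unfolding R_def using step
      by (intro residual_unchanged tent_node_other) (simp_all add: floor_log_block[of m])
    then show ?case
      using step by simp
  qed
  then have "apply_bcontfun (residual n f) u = apply_bcontfun R u -
      (\<Sum>i=2^m..<n. apply_bcontfun R (node i) * of_real (tent i (real_of_unit u)))"
    by (simp add: apply_bcontfun_sum)
  also have "norm \<dots> \<le> norm R + (\<Sum>i=2^m..<n. norm R * tent i (real_of_unit u))"
    by (intro norm_triangle_le_diff add_mono norm_bounded sum_norm_le)
      (auto simp: norm_mult tent_def hat_def intro!: mult_right_mono norm_bounded)
  also have "(\<Sum>i=2^m..<n. norm R * tent i (real_of_unit u)) \<le> norm R * 1"
    unfolding sum_distrib_left[symmetric]
  proof (rule mult_left_mono)
    have "(\<Sum>i=2^m..<n. tent i (real_of_unit u)) =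
        (\<Sum>i=2^m..<n. hat (2 ^ m * (real_of_unit u + 1) - real (Suc i)))"
      using assms by (intro sum.cong refl) (simp add: tent_def floor_log_block[of m])
    also have "\<dots> \<le> 1"
      using sum_hat_le[OF assms(1), of "2 ^ m * (real_of_unit u + 1)"] by simp
    finally show "(\<Sum>i=2^m..<n. tent i (real_of_unit u)) \<le> 1" .
  qed simp
  finally show "norm (apply_bcontfun (residual n f) u) \<le> 2 * norm (residual (2 ^ m) f)"
    by (simp add: R_def)
qed

lemma C01_uniformly_continuous:
  fixes f :: "'k::real_normed_field C01"
  assumes "0 < e"
  shows "\<exists>d>0. \<forall>u v. dist u v < d \<longrightarrow> norm (apply_bcontfun f u - apply_bcontfun f v) < e"
proof -
  have "dist (Abs_unit s) (Abs_unit t) = dist s t" if "s \<in> {0..1}" "t \<in> {0..1}" for s t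
    using that by (simp only: dist_unit_interval_def Abs_unit_inverse)
  then have "continuous_on {0..1} Abs_unit"
    unfolding continuous_on_iff by metis
  then have "continuous_on {0..1} (\<lambda>t. apply_bcontfun f (Abs_unit t))"
    by (rule continuous_on_compose2[OF continuous_on_apply_bcontfun[of UNIV]]) simp
  then have "uniformly_continuous_on {0..1} (\<lambda>t. apply_bcontfun f (Abs_unit t))"
    by (rule compact_uniformly_continuous) simp
  then obtain d where d: "0 < d" "\<And>s t. s \<in> {0..1} \<Longrightarrow> t \<in> {0..1} \<Longrightarrow> dist s t < d \<Longrightarrow>
      dist (apply_bcontfun f (Abs_unit s)) (apply_bcontfun f (Abs_unit t)) < e"
    using assms unfolding uniformly_continuous_on_def by metis
  have "norm (apply_bcontfun f u - apply_bcontfun f v) < e" if "dist u v < d" for u v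
    using d(2)[OF real_of_unit real_of_unit] that
    by (simp add: dist_unit_interval_def real_of_unit_inverse flip: dist_norm)
  then show ?thesis
    using d(1) by blast
qed

lemma residual_tendsto_0: "(\<lambda>n. residual n f) \<longlonglongrightarrow> 0"
proof (rule LIMSEQ_I)
  fix e :: real assume e: "0 < e"
  then obtain d where d: "0 < d"
    "\<And>u v. dist u v < d \<Longrightarrow> norm (apply_bcontfun f u - apply_bcontfun f v) < e / 4"
    using C01_uniformly_continuous[of "e / 4" f] by auto
  obtain M where M: "(1 / 2) ^ M < d"
    using real_arch_pow_inv[OF d(1), of "1 / 2"] by auto
  have "norm (residual n f) < e" if n: "2 ^ Suc M \<le> n" for n
  proof -
    have "Suc M \<le> floor_log n"
      using floor_log_le_iff[OF n] by simp
    then obtain m where m: "floor_log n = Suc m" "M \<le> m"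
      by (metis Suc_le_D Suc_le_mono)
    have "(1 / 2 :: real) ^ m \<le> (1 / 2) ^ M"
      using m(2) by (intro power_decreasing) auto
    then have "norm (residual (2 ^ Suc m) f) \<le> e / 4"
      using M by (intro norm_residual_grid less_imp_le d(2)) (simp add: power_one_over)
    moreover have "0 < n"
      using n by (metis gr0I le_zero_eq power_eq_0_iff zero_neq_numeral)
    then have "2 ^ Suc m \<le> n" "n \<le> 2 ^ Suc (Suc m)"
      using floor_log_bounds[of n] m(1) by (simp_all only: less_imp_le)
    then have "norm (residual n f) \<le> 2 * norm (residual (2 ^ Suc m) f)"
      by (rule norm_residual_block)
    ultimately show ?thesis
      using e by linarith
  qed
  then show "\<exists>N. \<forall>n\<ge>N. norm (residual n f - 0) < e"
    by auto
qed

section \<open>The tents form a frame but not a basis\<close>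

lemma residual_add: "residual n (f + g) = residual n f + residual n g"
proof (induction n)
  case (Suc n)
  show ?case
    by (rule bcontfun_eqI) (simp add: Suc.IH ring_distribs)
qed simp

lemma residual_scale: "residual n (scaleC01 c f) = scaleC01 c (residual n f)"
proof (induction n)
  case (Suc n)
  show ?case
    by (rule bcontfun_eqI) (simp add: Suc.IH ring_distribs mult.assoc)
qed simp

lemma continuous_residual_apply:
  "continuous_on UNIV (\<lambda>f. apply_bcontfun (residual n f) u)"
proof (induction n arbitrary: u)
  case 0
  have "dist (apply_bcontfun f u) (apply_bcontfun g u) \<le> dist f g" for f g :: "'a C01"
    by (rule dist_bounded)
  then show ?case
    by (auto simp: continuous_on_iff intro: le_less_trans)
next
  case (Suc n)
  then show ?case
    by (auto intro!: continuous_intros)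
qed

lemma tent_coeff_in_dual: "tent_coeff n \<in> topological_dual scaleC01"
proof -
  have "Vector_Spaces.linear scaleC01 (*) (tent_coeff n :: 'a C01 \<Rightarrow> 'a)"
    unfolding Vector_Spaces.linear_iff
    by (simp add: vector_space_scaleC01 vector_space_over_itself.vector_space_axioms
        tent_coeff_def residual_add residual_scale)
  then show ?thesis
    using continuous_residual_apply unfolding topological_dual_def tent_coeff_def by auto
qed

lemma schauder_frame_tent: "schauder_frame scaleC01 tentC01 tent_coeff"
proof -
  have "(\<lambda>n. f - residual n f) \<longlonglongrightarrow> f" for f :: "'a C01"
    using tendsto_diff[OF tendsto_const residual_tendsto_0, of f f] by simp
  then show ?thesis
    by (simp add: schauder_frame_def tent_coeff_in_dual sums_def sum_tent_coeff)
qed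

text \<open>
  Index 3 is the first whose centre, the point 1, has been used before (by index 1).
\<close>

lemma not_schauder_basis_tent: "\<not> schauder_basis scaleC01 (tentC01 :: nat \<Rightarrow> 'k::real_normed_field C01)"
proof
  assume basis: "schauder_basis scaleC01 (tentC01 :: nat \<Rightarrow> 'k C01)"
  define v :: "'k C01" where "v = tentC01 3"
  define \<delta> :: "nat \<Rightarrow> 'k" where "\<delta> n = of_bool (n = 3)" for n
  have frame: "(\<lambda>n. scaleC01 (tent_coeff n v) (tentC01 n)) sums v"
    using schauder_frame_tent unfolding schauder_frame_def by blast
  have single: "(\<lambda>n. scaleC01 (\<delta> n) (tentC01 n)) sums v"
  proof -
    have "scaleC01 (\<delta> n) (tentC01 n) = (if n = 3 then tentC01 n else 0)" for n
      by (rule bcontfun_eqI) (simp add: \<delta>_def)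
    then show ?thesis
      using sums_single[of 3 "tentC01 :: nat \<Rightarrow> 'k C01"] by (simp add: v_def)
  qed
  have "\<exists>!\<alpha>. (\<lambda>n. scaleC01 (\<alpha> n) (tentC01 n)) sums v"
    using basis unfolding schauder_basis_def by (rule spec)
  then obtain \<alpha> where "\<forall>\<beta>. (\<lambda>n. scaleC01 (\<beta> n) (tentC01 n)) sums v \<longrightarrow> \<beta> = \<alpha>"
    by (rule ex1E)
  from this[THEN spec, THEN mp, OF frame] this[THEN spec, THEN mp, OF single]
  have "(\<lambda>n. tent_coeff n v) = \<delta>"
    by (rule trans[OF _ sym])
  then have "tent_coeff 3 v = 1"
    by (simp add: \<delta>_def fun_eq_iff)
  moreover have "tent_coeff 3 v = 0"
  proof -
    have log: "floor_log 3 = 1" "floor_log 2 = 1"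
      by (simp_all add: floor_log_block[of 1])
    then have "real_of_unit (node 3) = 1"
      by (simp add: real_of_node)
    then have "apply_bcontfun (residual 2 v) (node 3) = 0"
      using residual_grid_eq_0[of "node 3" 1 0 v] by simp
    moreover have "tent 2 (real_of_unit (node 3)) = 0"
      using log by (intro tent_node_other) simp_all
    ultimately show ?thesis
      using residual.simps(2)[of 2 v] by (simp add: tent_coeff_def)
  qed
  ultimately show False
    by simp
qed

lemma tent_frame_not_basis:
  "\<exists>(\<phi> :: nat \<Rightarrow> 'k::real_normed_field C01) A. (\<forall>n. piecewise_linear (\<phi> n)) \<and>
     schauder_frame scaleC01 \<phi> A \<and> \<not> schauder_basis scaleC01 \<phi>"
proof (intro exI conjI allI)
  show "piecewise_linear (tentC01 n :: 'k C01)" for n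
    by (rule dyadic_linear_imp_piecewise_linear[OF dyadic_linear_tent[OF order_refl]])
qed (rule schauder_frame_tent not_schauder_basis_tent)+

theorem mainTheorem8:
  shows "(\<exists>(\<phi> :: nat \<Rightarrow> real C01) (A :: nat \<Rightarrow> real C01 \<Rightarrow> real).
            (\<forall>n. piecewise_linear (\<phi> n)) \<and>
            schauder_frame scaleC01 \<phi> A \<and> \<not> schauder_basis scaleC01 \<phi>) \<and>
         (\<exists>(\<phi> :: nat \<Rightarrow> complex C01) (A :: nat \<Rightarrow> complex C01 \<Rightarrow> complex).
            (\<forall>n. piecewise_linear (\<phi> n)) \<and>
            schauder_frame scaleC01 \<phi> A \<and> \<not> schauder_basis scaleC01 \<phi>)"
  by (intro conjI tent_frame_not_basis)

end
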